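(* Let $\gamma=[a_1,a_2,a_3,\ldots]\in(0,1/2)\setminus\mathbb Q$ with convergents $p_n/q_n=[a_1,\ldots,a_n]$. Put $A_0=0$ and $A_m=\sum_{r=1}^m a_{2r}$ for $m\ge1$. Let $f\in\mathcal S_\gamma$, with cutting times $S_0<S_1<\cdots$, co-cutting times $\widetilde S_0<\widetilde S_1<\cdots$ and first disagreement time function $R$. For every $m\ge0$ and $1\le j\le a_{2m+2}$, $$\widetilde S_{A_m+j-1}=q_{2m}+j\,q_{2m+1}.$$ In particular, $$\widetilde S_{A_m-1}=q_{2m},\qquad \widetilde S_{A_m}=q_{2m}+q_{2m+1}$$ for every $m\ge1$. Moreover, if $d_m=q_{2m+1}-p_{2m+1}$, then $$S_{d_m}=q_{2m+1}\quad\text{for every } m\ge0,$$ and $$R(q_{2m})=q_{2m+1}\quad\text{for every } m\ge1.$$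
   Context: $\mathbb N$ is the set of positive integers, $\mathbb N_0=\mathbb N\cup\{0\}$, and $[a,b]$ denotes the closed interval with endpoints $a,b$ in whichever order. Continued fractions: $[a_1,a_2,\ldots]=1/(a_1+1/(a_2+\cdots))$, with $p_0=0,q_0=1,p_1=1,q_1=a_1$, $p_{n+1}=a_{n+1}p_n+p_{n-1}$, $q_{n+1}=a_{n+1}q_n+q_{n-1}$. Unimodal map: a continuous noninjective map $f:I\to I$ of a compact interval $I$ with $f(\partial I)\subset\partial I$, having a unique turning point $c\in\mathrm{int}(I)$, which is a maximum: $f$ is strictly increasing to the left of $c$ and strictly decreasing to the right. Write $c_n=f^n(c)$. Standing normalization: $c_2<c<c_1$ and $c_2<c_3$. Kneading map: let $D_1=[c,c_1]$ and, for $n\ge2$, $D_n=f(D_{n-1})$ if $c\notin D_{n-1}$, $D_n=[c_n,c_1]$ if $c\in D_{n-1}$. An integer $n\ge1$ is a cutting time if $c\in D_n$; cutting times are enumerated as $1=S_0<S_1=2<S_2<\cdots$. The difference of consecutive cutting times is a cutting time, and the kneading map $Q:\mathbb N\to\mathbb N_0$ is defined by $S_k-S_{k-1}=S_{Q(k)}$. For $\gamma\in(0,1/2)\setminus\mathbb Q$ put $\omega_\gamma=\gamma/(1-\gamma)$ and $Q_\gamma(k)=\lfloor k\omega_\gamma\rfloor-\lfloor(k-1)\omega_\gamma\rfloor$, $k\ge1$. $\mathcal S_\gamma$ is the set of unimodal maps with kneading map $Q_\gamma$. Kneading sequence, disagreement times and co-cutting times: for $f\in\mathcal S_\gamma$ the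 turning point is not periodic and the kneading sequence is $K(f)=e_1e_2e_3\cdots\in\{0,1\}^{\mathbb N}$ with $e_j=0$ if $c_j<c$ and $e_j=1$ if $c_j>c$; it is not a periodic sequence. For $m\ge1$, $R(m)=\min\{r\ge1: e_{m+r}\ne e_r\}$ (finite). Let $\kappa=\min\{n\ge2:e_n=1\}$. The co-cutting times are defined by $\widetilde S_0=\kappa$ and $\widetilde S_{j+1}=\widetilde S_j+R(\widetilde S_j)$ for $j\ge0$. *)

theory Defs
  imports "HOL-Analysis.Analysis"
begin

section \<open>Continued fractions\<close>

text \<open>Partial quotients are a function \<open>a\<close> on the naturals of which only
  \<open>a 1, a 2, \<dots>\<close> are used; \<open>a 0\<close> is irrelevant.\<close>

definition cf_finite :: "(nat \<Rightarrow> nat) \<Rightarrow> nat \<Rightarrow> real" where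
  "cf_finite a n = foldr (\<lambda>k t. 1 / (real (a k) + t)) [1..<Suc n] 0"

definition has_cf_expansion :: "real \<Rightarrow> (nat \<Rightarrow> nat) \<Rightarrow> bool" where
  "has_cf_expansion \<gamma> a \<longleftrightarrow> (\<forall>n\<ge>1. a n \<ge> 1) \<and> cf_finite a \<longlonglongrightarrow> \<gamma>"

fun cf_p :: "(nat \<Rightarrow> nat) \<Rightarrow> nat \<Rightarrow> nat" where
  "cf_p a 0 = 0"
| "cf_p a (Suc 0) = 1"
| "cf_p a (Suc (Suc n)) = a (Suc (Suc n)) * cf_p a (Suc n) + cf_p a n"

fun cf_q :: "(nat \<Rightarrow> nat) \<Rightarrow> nat \<Rightarrow> nat" where
  "cf_q a 0 = 1"
| "cf_q a (Suc 0) = a 1"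
| "cf_q a (Suc (Suc n)) = a (Suc (Suc n)) * cf_q a (Suc n) + cf_q a n"

lemma cf_q_pos: "(\<And>n. n \<ge> 1 \<Longrightarrow> a n \<ge> 1) \<Longrightarrow> cf_q a n > 0"
  by (induction a n rule: cf_q.induct) (auto simp: Suc_le_eq)

lemma cf_finite_tail:
  assumes "\<And>n. n \<ge> 1 \<Longrightarrow> a n \<ge> 1" and "t \<ge> 0"
  shows "foldr (\<lambda>k t. 1 / (real (a k) + t)) [1..<Suc (Suc n)] t =
    (real (cf_p a (Suc n)) + t * real (cf_p a n)) / (real (cf_q a (Suc n)) + t * real (cf_q a n))"
  using assms(2)
proof (induction n arbitrary: t)
  case 0
  then show ?case by simp
next
  case (Suc n)
  let ?b = "real (a (Suc (Suc n))) + t"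
  have b: "?b > 0"
    using assms(1)[of "Suc (Suc n)"] Suc.prems by simp
  have "foldr (\<lambda>k t. 1 / (real (a k) + t)) [1..<Suc (Suc (Suc n))] t
      = foldr (\<lambda>k t. 1 / (real (a k) + t)) [1..<Suc (Suc n)] (1 / ?b)"
    by simp
  also have "\<dots> = (real (cf_p a (Suc n)) + 1 / ?b * real (cf_p a n)) /
                (real (cf_q a (Suc n)) + 1 / ?b * real (cf_q a n))"
    using b by (intro Suc.IH) simp
  also have "\<dots> = (?b * (real (cf_p a (Suc n)) + 1 / ?b * real (cf_p a n))) /
                (?b * (real (cf_q a (Suc n)) + 1 / ?b * real (cf_q a n)))"
    using b by simp
  also have "?b * (real (cf_p a (Suc n)) + 1 / ?b * real (cf_p a n))
      = ?b * real (cf_p a (Suc n)) + real (cf_p a n)"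
    using b by (simp add: distrib_left)
  also have "?b * (real (cf_q a (Suc n)) + 1 / ?b * real (cf_q a n))
      = ?b * real (cf_q a (Suc n)) + real (cf_q a n)"
    using b by (simp add: distrib_left)
  finally show ?case
    by (simp add: algebra_simps)
qed

lemma cf_finite_eq_convergent:
  assumes "\<And>n. n \<ge> 1 \<Longrightarrow> a n \<ge> 1"
  shows "cf_finite a n = real (cf_p a n) / real (cf_q a n)"
proof (cases n)
  case 0
  then show ?thesis by (simp add: cf_finite_def)
next
  case (Suc k)
  then show ?thesis
    using cf_finite_tail[of a 0 k, OF assms] by (simp only: cf_finite_def) simp
qed

definition even_quotient_sum :: "(nat \<Rightarrow> nat) \<Rightarrow> nat \<Rightarrow> nat" where
  "even_quotient_sum a m = (\<Sum>r=1..m. a (2 * r))"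


section \<open>Unimodal maps and kneading data\<close>

text \<open>A unimodal map of \<open>I = [l, u]\<close> with turning point \<open>c\<close>. The map is a total function on
  the reals, but only its values on \<open>I\<close> are constrained or ever used. Uniqueness of the turning
  point, and its being a maximum, are consequences of the two monotonicity conditions.\<close>

definition unimodal :: "real \<Rightarrow> real \<Rightarrow> real \<Rightarrow> (real \<Rightarrow> real) \<Rightarrow> bool" where
  "unimodal l u c f \<longleftrightarrow>
     l < c \<and> c < u \<and> continuous_on {l..u} f \<and> f ` {l..u} \<subseteq> {l..u} \<and> \<not> inj_on f {l..u} \<and>
     f ` {l, u} \<subseteq> {l, u} \<and> strict_mono_on {l..c} f \<and> strict_antimono_on {c..u} f"

definition crit_orbit :: "(real \<Rightarrow> real) \<Rightarrow> real \<Rightarrow> nat \<Rightarrow> real" where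
  "crit_orbit f c n = (f ^^ n) c"

definition normalized_unimodal :: "real \<Rightarrow> real \<Rightarrow> real \<Rightarrow> (real \<Rightarrow> real) \<Rightarrow> bool" where
  "normalized_unimodal l u c f \<longleftrightarrow> unimodal l u c f \<and>
     crit_orbit f c 2 < c \<and> c < crit_orbit f c 1 \<and> crit_orbit f c 2 < crit_orbit f c 3"

text \<open>The intervals \<open>D n\<close> are indexed from 1; the value at 0 is a dummy.\<close>

fun cut_interval :: "(real \<Rightarrow> real) \<Rightarrow> real \<Rightarrow> nat \<Rightarrow> real set" where
  "cut_interval f c 0 = {}"
| "cut_interval f c (Suc 0) = closed_segment c (crit_orbit f c 1)"
| "cut_interval f c (Suc (Suc n)) =
     (if c \<in> cut_interval f c (Suc n)
      then closed_segment (crit_orbit f c (Suc (Suc n))) (crit_orbit f c 1)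
      else f ` cut_interval f c (Suc n))"

definition cutting_times :: "(real \<Rightarrow> real) \<Rightarrow> real \<Rightarrow> nat set" where
  "cutting_times f c = {n. n \<ge> 1 \<and> c \<in> cut_interval f c n}"

definition cutting_time :: "(real \<Rightarrow> real) \<Rightarrow> real \<Rightarrow> nat \<Rightarrow> nat" where
  "cutting_time f c = enumerate (cutting_times f c)"

text \<open>A kneading map is defined at every \<open>k \<ge> 1\<close>, which requires infinitely many cutting times;
  it is then uniquely determined there, since \<open>cutting_time f c\<close> is injective.\<close>

definition has_kneading_map :: "(real \<Rightarrow> real) \<Rightarrow> real \<Rightarrow> (nat \<Rightarrow> nat) \<Rightarrow> bool" where
  "has_kneading_map f c Q \<longleftrightarrow> infinite (cutting_times f c) \<and>
     (\<forall>k\<ge>1. cutting_time f c k - cutting_time f c (k - 1) = cutting_time f c (Q k))"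

definition kneading_Q :: "real \<Rightarrow> nat \<Rightarrow> nat" where
  "kneading_Q \<gamma> k =
     (let \<omega> = \<gamma> / (1 - \<gamma>) in nat (\<lfloor>real k * \<omega>\<rfloor> - \<lfloor>(real k - 1) * \<omega>\<rfloor>))"

definition in_S_class :: "real \<Rightarrow> real \<Rightarrow> real \<Rightarrow> real \<Rightarrow> (real \<Rightarrow> real) \<Rightarrow> bool" where
  "in_S_class \<gamma> l u c f \<longleftrightarrow> normalized_unimodal l u c f \<and> has_kneading_map f c (kneading_Q \<gamma>)"

text \<open>For maps in the class above the turning point is not periodic, so the case
  \<open>crit_orbit f c j = c\<close>, which gets the value 0 here, does not arise for \<open>j \<ge> 1\<close>.\<close>

definition kneading_seq :: "(real \<Rightarrow> real) \<Rightarrow> real \<Rightarrow> nat \<Rightarrow> nat" where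
  "kneading_seq f c j = (if crit_orbit f c j > c then 1 else 0)"

definition disagreement :: "(real \<Rightarrow> real) \<Rightarrow> real \<Rightarrow> nat \<Rightarrow> nat" where
  "disagreement f c m = (LEAST r. r \<ge> 1 \<and> kneading_seq f c (m + r) \<noteq> kneading_seq f c r)"

definition kneading_kappa :: "(real \<Rightarrow> real) \<Rightarrow> real \<Rightarrow> nat" where
  "kneading_kappa f c = (LEAST n. n \<ge> 2 \<and> kneading_seq f c n = 1)"

primrec cocutting_time :: "(real \<Rightarrow> real) \<Rightarrow> real \<Rightarrow> nat \<Rightarrow> nat" where
  "cocutting_time f c 0 = kneading_kappa f c"
| "cocutting_time f c (Suc j) = cocutting_time f c j + disagreement f c (cocutting_time f c j)"

end

theory Submission
  imports Defs
begin

text \<open>Put \<open>\<omega> = \<gamma> / (1 - \<gamma>)\<close>. Since \<open>Q\<^sub>\<gamma>\<close> takes only the values 0 and 1, the cutting times are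
  \<open>S k = 1 + k + \<lfloor>k \<omega>\<rfloor>\<close> and the kneading sequence is a 1 followed by the blocks 0 (where
  \<open>Q\<^sub>\<gamma> k = 0\<close>) and 11 (where \<open>Q\<^sub>\<gamma> k = 1\<close>). If the \<open>k\<close>-th block is 11 and starts at position
  \<open>m = S k - 1\<close>, then comparing the sequence after \<open>m\<close> with itself amounts to comparing
  \<open>Q\<^sub>\<gamma> (k + i)\<close> with \<open>Q\<^sub>\<gamma> i\<close>, and these differ first at the least \<open>i\<close> for which the
  fractional parts of \<open>k \<omega>\<close> and \<open>i \<omega>\<close> add up to at least 1; then \<open>R m = S i\<close>, and a block 11
  starts at \<open>m + R m\<close>. As the convergents of \<open>\<omega>\<close> are \<open>p\<^sub>n / (q\<^sub>n - p\<^sub>n)\<close>, the best approximation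
  property identifies \<open>i\<close> as an odd-indexed convergent denominator, and the indices \<open>k\<close>
  visited by the co-cutting times as the denominators of the intermediate fractions below \<open>\<omega>\<close>.\<close>

section \<open>Convergents\<close>

lemma cf_det:
  "int (cf_p a (Suc n)) * int (cf_q a n) - int (cf_p a n) * int (cf_q a (Suc n)) = (-1) ^ n"
proof (induction n)
  case (Suc n)
  have "int (cf_p a (Suc (Suc n))) * int (cf_q a (Suc n))
      - int (cf_p a (Suc n)) * int (cf_q a (Suc (Suc n)))
      = - (int (cf_p a (Suc n)) * int (cf_q a n) - int (cf_p a n) * int (cf_q a (Suc n)))"
    by (simp add: algebra_simps)
  with Suc show ?case by simp
qed simp

locale cf_below_half =
  fixes \<gamma> :: real and a :: "nat \<Rightarrow> nat"
  assumes cf: "has_cf_expansion \<gamma> a"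
    and gamma_pos: "0 < \<gamma>" and gamma_less: "\<gamma> < 1 / 2"
begin

definition \<omega> :: real where "\<omega> = \<gamma> / (1 - \<gamma>)"

text \<open>The convergent \<open>p / q\<close> of \<open>\<gamma>\<close> corresponds under
  \<open>x / (1 - x)\<close> to \<open>p / (q - p)\<close>. The truncated subtraction is harmless by
  \<open>p_less_q\<close>.\<close>

definition den :: "nat \<Rightarrow> nat" where "den n = cf_q a n - cf_p a n"

definition err :: "nat \<Rightarrow> real" where "err n = real (den n) * \<omega> - real (cf_p a n)"

definition floor_mult :: "nat \<Rightarrow> nat" where "floor_mult k = nat \<lfloor>real k * \<omega>\<rfloor>"

lemma a_pos: "n \<ge> 1 \<Longrightarrow> a n \<ge> 1"
  using cf by (simp add: has_cf_expansion_def)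

lemma omega_pos: "0 < \<omega>" and omega_less: "\<omega> < 1"
  using gamma_pos gamma_less by (auto simp: \<omega>_def divide_simps)

lemma q_pos: "0 < cf_q a n"
  using cf_q_pos[of a n] a_pos by blast

section \<open>Monotonicity of the even and odd convergents\<close>

lemma cf_finite_diff2:
  "cf_finite a (Suc (Suc n)) - cf_finite a n
     = (-1) ^ n * real (a (Suc (Suc n))) / (real (cf_q a n) * real (cf_q a (Suc (Suc n))))"
proof -
  have d: "real (cf_p a (Suc n)) * real (cf_q a n) - real (cf_p a n) * real (cf_q a (Suc n)) = (-1) ^ n"
    using arg_cong[OF cf_det[of a n], of real_of_int] by simp
  have "real (cf_p a (Suc (Suc n))) * real (cf_q a n) - real (cf_p a n) * real (cf_q a (Suc (Suc n)))
      = real (a (Suc (Suc n))) *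
        (real (cf_p a (Suc n)) * real (cf_q a n) - real (cf_p a n) * real (cf_q a (Suc n)))"
    by (simp add: algebra_simps)
  then have e: "real (cf_p a (Suc (Suc n))) * real (cf_q a n) - real (cf_p a n) * real (cf_q a (Suc (Suc n)))
      = (-1) ^ n * real (a (Suc (Suc n)))"
    unfolding d by simp
  have conv: "cf_finite a i = real (cf_p a i) / real (cf_q a i)" for i
    using a_pos by (intro cf_finite_eq_convergent)
  have nz: "real (cf_q a n) \<noteq> 0" "real (cf_q a (Suc (Suc n))) \<noteq> 0"
    using q_pos[of n] q_pos[of "Suc (Suc n)"] by (simp_all del: cf_q.simps)
  show ?thesis
    unfolding conv diff_frac_eq[OF nz(2) nz(1)] e by (simp add: mult.commute)
qed

text \<open>The even convergents increase strictly to \<open>\<gamma>\<close>; passing to the next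
  one turns the weak bound by the limit into a strict one.\<close>

lemma even_convergent_less: "cf_finite a (2 * m) < \<gamma>"
proof -
  let ?x = "\<lambda>m. cf_finite a (2 * m)"
  have step: "?x m < ?x (Suc m)" for m
  proof -
    have "?x (Suc m) - ?x m > 0"
      using cf_finite_diff2[of "2 * m"] a_pos[of "Suc (Suc (2 * m))"]
        q_pos[of "2 * m"] q_pos[of "Suc (Suc (2 * m))"]
      by (simp del: cf_q.simps)
    then show ?thesis by simp
  qed
  have lim: "?x \<longlonglongrightarrow> \<gamma>"
    using cf LIMSEQ_subseq_LIMSEQ[of "cf_finite a" \<gamma> "\<lambda>m. 2 * m"]
    by (simp add: has_cf_expansion_def o_def strict_mono_def)
  have "incseq ?x"
    using step by (intro incseq_SucI less_imp_le)
  then have "?x (Suc m) \<le> \<gamma>"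
    using incseq_le lim by blast
  with step[of m] show ?thesis by simp
qed

lemma odd_convergent_greater: "\<gamma> < cf_finite a (Suc (2 * m))"
proof -
  let ?x = "\<lambda>m. cf_finite a (Suc (2 * m))"
  have step: "?x (Suc m) < ?x m" for m
  proof -
    have "?x (Suc m) - ?x m < 0"
      using cf_finite_diff2[of "Suc (2 * m)"] a_pos[of "Suc (Suc (Suc (2 * m)))"]
        q_pos[of "Suc (2 * m)"] q_pos[of "Suc (Suc (Suc (2 * m)))"]
      by (simp del: cf_q.simps)
    then show ?thesis by simp
  qed
  have lim: "?x \<longlonglongrightarrow> \<gamma>"
    using cf LIMSEQ_subseq_LIMSEQ[of "cf_finite a" \<gamma> "\<lambda>m. Suc (2 * m)"]
    by (simp add: has_cf_expansion_def o_def strict_mono_def)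
  have "decseq ?x"
    using step by (intro decseq_SucI less_imp_le)
  then have "\<gamma> \<le> ?x (Suc m)"
    using decseq_ge lim by blast
  with step[of m] show ?thesis by simp
qed

text \<open>If \<open>a 1 = 1\<close>, the second convergent is \<open>a 2 / (a 2 + 1)\<close>, at
  least 1/2, yet it lies below \<open>\<gamma>\<close>.\<close>

lemma a1_ge_2: "a 1 \<ge> 2"
proof (rule ccontr)
  assume "\<not> a 1 \<ge> 2"
  with a_pos[of 1] have a1: "a 1 = 1" by simp
  have "cf_finite a 2 = real (cf_p a 2) / real (cf_q a 2)"
    using a_pos by (intro cf_finite_eq_convergent)
  also have "\<dots> = real (a 2) / (real (a 2) + 1)"
    using a1 by (simp add: numeral_2_eq_2)
  also have "\<dots> \<ge> 1 / 2"
    using a_pos[of 2] by (simp add: divide_simps)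
  finally show False
    using even_convergent_less[of 1] gamma_less by simp
qed

lemma p_less_q: "cf_p a n < cf_q a n"
proof -
  have "cf_p a n < cf_q a n \<and> cf_p a (Suc n) < cf_q a (Suc n)"
  proof (induction n)
    case 0
    show ?case using a1_ge_2 by simp
  next
    case (Suc n)
    then show ?case by (simp add: add_le_less_mono)
  qed
  then show ?thesis ..
qed

lemma den_pos: "0 < den n"
  using p_less_q by (simp add: den_def)

lemma p_plus_den: "cf_p a n + den n = cf_q a n"
  using p_less_q[of n] by (simp add: den_def)

section \<open>Signed approximation errors for \<open>\<omega>\<close>\<close>

lemma err_alt: "err n = real (cf_q a n) * (\<gamma> - cf_finite a n) / (1 - \<gamma>)"
proof -
  have fin: "cf_finite a n = real (cf_p a n) / real (cf_q a n)"
    using a_pos by (intro cf_finite_eq_convergent)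
  have d: "real (den n) = real (cf_q a n) - real (cf_p a n)"
    using p_less_q[of n] by (simp add: den_def of_nat_diff)
  show ?thesis
    using gamma_less q_pos[of n] unfolding err_def fin d \<omega>_def by (simp add: field_simps)
qed

lemma err_even_pos: "0 < err (2 * m)"
  using even_convergent_less[of m] q_pos[of "2 * m"] gamma_less by (simp add: err_alt)

lemma err_odd_neg: "err (Suc (2 * m)) < 0"
  using odd_convergent_greater[of m] q_pos[of "Suc (2 * m)"] gamma_less
  by (simp add: err_alt divide_neg_pos mult_pos_neg)

lemma den_Suc_Suc: "den (Suc (Suc n)) = a (Suc (Suc n)) * den (Suc n) + den n"
proof -
  have "cf_p a (Suc (Suc n)) + den (Suc (Suc n))
      = a (Suc (Suc n)) * (cf_p a (Suc n) + den (Suc n)) + (cf_p a n + den n)"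
    unfolding p_plus_den by simp
  then show ?thesis by (simp add: algebra_simps)
qed

lemma err_Suc_Suc: "err (Suc (Suc n)) = real (a (Suc (Suc n))) * err (Suc n) + err n"
  by (simp add: err_def den_Suc_Suc algebra_simps)

lemma err_even_antimono: "m \<le> n \<Longrightarrow> err (2 * n) \<le> err (2 * m)"
proof (induction rule: dec_induct)
  case (step n)
  have "real (a (Suc (Suc (2 * n)))) * err (Suc (2 * n)) \<le> 0"
    using err_odd_neg[of n] by (intro mult_nonneg_nonpos) auto
  with step show ?case using err_Suc_Suc[of "2 * n"] by simp
qed simp

lemma err_0: "err 0 = \<omega>"
  by (simp add: err_def den_def)

text \<open>The expression decreases in \<open>j\<close> and reaches \<open>err (2 * m + 2)\<close>,
  still positive, at the largest admissible \<open>j\<close>.\<close>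

lemma err_intermediate_pos:
  assumes "j \<le> a (2 * m + 2)"
  shows "0 < err (2 * m) + real j * err (Suc (2 * m))"
proof -
  have "real (a (Suc (Suc (2 * m)))) * err (Suc (2 * m)) \<le> real j * err (Suc (2 * m))"
    using assms err_odd_neg[of m] by (intro mult_right_mono_neg) auto
  then show ?thesis
    using err_even_pos[of "Suc m"] err_Suc_Suc[of "2 * m"] by simp
qed

text \<open>All these errors descend from \<open>err 0 = \<omega>\<close>. Equality holds at
  \<open>m = j = 0\<close>, the one excluded pair.\<close>

lemma err_intermediate_less:
  assumes "j \<ge> 1 \<or> m \<ge> 1"
  shows "err (2 * m) + real j * err (Suc (2 * m)) < \<omega>"
proof (cases "j \<ge> 1")
  case True
  then have "real j * err (Suc (2 * m)) < 0"
    using err_odd_neg[of m] by (intro mult_pos_neg) auto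
  then show ?thesis
    using err_even_antimono[of 0 m] err_0 by simp
next
  case False
  with assms have "m \<ge> 1" "j = 0" by auto
  have "err 2 < err 0"
    using err_Suc_Suc[of 0] err_odd_neg[of 0] a_pos[of 2]
    by (simp add: mult_pos_neg numeral_2_eq_2)
  then show ?thesis
    using err_even_antimono[OF \<open>m \<ge> 1\<close>] err_0 \<open>j = 0\<close> by simp
qed

lemma err_odd_gt: "- \<omega> < err (Suc (2 * m))"
  using err_intermediate_pos[of 1 m] a_pos[of "2 * m + 2"] err_even_antimono[of 0 m] err_0 by simp

text \<open>The vectors \<open>(den (2 m), p (2 m))\<close> and \<open>(den (2 m + 1), p (2 m + 1))\<close> form a basis of
  the integer lattice; the signs of the coordinates of \<open>(i, h)\<close> decide the claim.\<close>

lemma best_approximation: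
  fixes i h :: int
  assumes "0 < i" "i < int (den (Suc (2 * m)))" "real_of_int i * \<omega> < real_of_int h"
  shows "real_of_int i * \<omega> - real_of_int h < - err (2 * m)"
proof -
  define P0 P1 Q0 Q1 where "P0 = int (cf_p a (2 * m))" and "P1 = int (cf_p a (Suc (2 * m)))"
    and "Q0 = int (den (2 * m))" and "Q1 = int (den (Suc (2 * m)))"
  have Q: "Q0 > 0" "Q1 > 0"
    using den_pos by (auto simp: Q0_def Q1_def)
  have qs: "int (cf_q a (2 * m)) = P0 + Q0" "int (cf_q a (Suc (2 * m))) = P1 + Q1"
    unfolding P0_def P1_def Q0_def Q1_def by (metis of_nat_add p_plus_den)+
  have det: "P1 * Q0 - P0 * Q1 = 1"
    using cf_det[of a "2 * m"] unfolding qs P0_def[symmetric] P1_def[symmetric]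
    by (simp add: algebra_simps)
  \<comment> \<open>Cramer's rule with determinant 1: integer coordinates of \<open>(i, h)\<close>
    with respect to \<open>(Q0, P0)\<close> and \<open>(Q1, P1)\<close>.\<close>
  define x y where "x = i * P1 - h * Q1" and "y = h * Q0 - i * P0"
  have "x * Q0 + y * Q1 = i * (P1 * Q0 - P0 * Q1)"
    by (simp add: x_def y_def algebra_simps)
  then have i: "i = x * Q0 + y * Q1" using det by simp
  have "x * P0 + y * P1 = h * (P1 * Q0 - P0 * Q1)"
    by (simp add: x_def y_def algebra_simps)
  then have h: "h = x * P0 + y * P1" using det by simp
  have val: "real_of_int i * \<omega> - real_of_int h
      = real_of_int x * err (2 * m) + real_of_int y * err (Suc (2 * m))"
    unfolding i h by (simp add: err_def P0_def P1_def Q0_def Q1_def algebra_simps)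
  have pos: "err (2 * m) > 0" and neg: "err (Suc (2 * m)) < 0"
    using err_even_pos err_odd_neg by auto
  \<comment> \<open>For \<open>y \<le> 0\<close>, either \<open>x \<ge> 0\<close> makes the error
    nonnegative, or \<open>x < 0\<close> makes \<open>i\<close> nonpositive.\<close>
  have y: "y \<ge> 1"
  proof (rule ccontr)
    assume "\<not> y \<ge> 1"
    then have "y \<le> 0" by simp
    show False
    proof (cases "x \<ge> 0")
      case True
      then have "real_of_int x * err (2 * m) \<ge> 0" "real_of_int y * err (Suc (2 * m)) \<ge> 0"
        using \<open>y \<le> 0\<close> pos neg by (auto intro: mult_nonneg_nonneg mult_nonpos_nonpos)
      with val assms show False by linarith
    next
      case False
      then have "x * Q0 \<le> 0" "y * Q1 \<le> 0"
        using \<open>y \<le> 0\<close> Q by (auto simp: mult_le_0_iff)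
      with i assms show False by linarith
    qed
  qed
  \<comment> \<open>Otherwise \<open>i\<close> would be at least \<open>Q1\<close>.\<close>
  have x: "x \<le> -1"
  proof (rule ccontr)
    assume "\<not> x \<le> -1"
    then have "x * Q0 \<ge> 0" "1 * Q1 \<le> y * Q1"
      using y Q by (auto intro!: mult_nonneg_nonneg mult_right_mono)
    with i assms(2) show False unfolding Q1_def[symmetric] by linarith
  qed
  have "real_of_int x * err (2 * m) \<le> (-1) * err (2 * m)"
    using x pos by (intro mult_right_mono) auto
  moreover have "real_of_int y * err (Suc (2 * m)) < 0"
    using y neg by (intro mult_pos_neg) auto
  ultimately show ?thesis using val by linarith
qed

section \<open>Floors of multiples of \<open>\<omega>\<close> and their carries\<close>

lemma floor_multI:
  assumes "real n \<le> real k * \<omega>" "real k * \<omega> < real n + 1"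
  shows "floor_mult k = n"
  using assms by (simp add: floor_mult_def floor_eq_iff nat_eq_iff)

lemma floor_mult_bounds: "real (floor_mult k) \<le> real k * \<omega>" "real k * \<omega> < real (floor_mult k) + 1"
proof -
  have "0 \<le> real k * \<omega>" using omega_pos by simp
  then show "real (floor_mult k) \<le> real k * \<omega>" "real k * \<omega> < real (floor_mult k) + 1"
    unfolding floor_mult_def by (auto simp: of_nat_nat)
qed

lemma floor_mult_0: "floor_mult 0 = 0"
  by (simp add: floor_mult_def)

lemma floor_mult_Suc: "floor_mult (Suc k) = floor_mult k \<or> floor_mult (Suc k) = Suc (floor_mult k)"
proof -
  have "real (Suc k) * \<omega> = real k * \<omega> + \<omega>" by (simp add: algebra_simps)
  then have "real (floor_mult (Suc k)) < real (floor_mult k) + 2"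
    "real (floor_mult k) < real (floor_mult (Suc k)) + 1"
    using floor_mult_bounds[of k] floor_mult_bounds[of "Suc k"] omega_pos omega_less by linarith+
  then show ?thesis by linarith
qed

lemma kneading_Q_Suc: "kneading_Q \<gamma> (Suc k) = floor_mult (Suc k) - floor_mult k"
proof -
  have "0 \<le> \<lfloor>real k * \<omega>\<rfloor>" "0 \<le> \<lfloor>(1 + real k) * \<omega>\<rfloor>" using omega_pos by simp_all
  then show ?thesis
    unfolding kneading_Q_def Let_def \<omega>_def[symmetric] floor_mult_def
    by (simp add: nat_diff_distrib')
qed

text \<open>The multiple falls short of the integer \<open>p\<close> by less than
  \<open>\<omega>\<close>, hence by less than 1.\<close>

lemma floor_mult_den_odd: "Suc (floor_mult (den (Suc (2 * m)))) = cf_p a (Suc (2 * m))"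
proof -
  let ?p = "cf_p a (Suc (2 * m))"
  have e: "real (den (Suc (2 * m))) * \<omega> = real ?p + err (Suc (2 * m))"
    by (simp add: err_def)
  have "?p \<ge> 1"
  proof -
    have "0 < real (den (Suc (2 * m))) * \<omega>"
      using den_pos[of "Suc (2 * m)"] omega_pos by simp
    then have "0 < real ?p" using e err_odd_neg[of m] by linarith
    then show ?thesis by linarith
  qed
  then have "floor_mult (den (Suc (2 * m))) = ?p - 1"
    using e err_odd_gt[of m] err_odd_neg[of m] omega_less by (intro floor_multI) auto
  with \<open>?p \<ge> 1\<close> show ?thesis by simp
qed

lemma intermediate_mult:
  "real (den (2 * m) + j * den (Suc (2 * m))) * \<omega>
     = real (cf_p a (2 * m) + j * cf_p a (Suc (2 * m)))
       + (err (2 * m) + real j * err (Suc (2 * m)))"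
  by (simp add: err_def algebra_simps)

lemma floor_mult_intermediate:
  assumes "j \<le> a (2 * m + 2)" "j \<ge> 1 \<or> m \<ge> 1"
  shows "floor_mult (den (2 * m) + j * den (Suc (2 * m))) = cf_p a (2 * m) + j * cf_p a (Suc (2 * m))"
  using intermediate_mult[of m j] err_intermediate_pos[OF assms(1)]
    err_intermediate_less[OF assms(2)] omega_less
  by (intro floor_multI) auto

text \<open>The fractional part at this index is below \<open>\<omega>\<close>, so the preceding
  multiple lies under the same integer. In the kneading sequence this index therefore carries a
  block 11.\<close>

lemma floor_mult_intermediate_pred:
  assumes "j \<le> a (2 * m + 2)" "j \<ge> 1 \<or> m \<ge> 1"
  shows "floor_mult (den (2 * m) + j * den (Suc (2 * m)))
     = Suc (floor_mult (den (2 * m) + j * den (Suc (2 * m)) - 1))"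
proof -
  let ?k = "den (2 * m) + j * den (Suc (2 * m))" and ?p = "cf_p a (2 * m) + j * cf_p a (Suc (2 * m))"
  have "?k \<ge> 1" using den_pos[of "2 * m"] by simp
  then have "real (?k - 1) * \<omega> = real ?k * \<omega> - \<omega>"
    by (simp add: of_nat_diff algebra_simps)
  then have "real (?k - 1) * \<omega> < real ?p"
    using intermediate_mult[of m j] err_intermediate_less[OF assms(2)] by simp
  then have "real (floor_mult (?k - 1)) < real ?p"
    using floor_mult_bounds(1)[of "?k - 1"] by linarith
  then have "floor_mult (?k - 1) < floor_mult ?k"
    using floor_mult_intermediate[OF assms] by (simp del: of_nat_add of_nat_mult)
  moreover have "floor_mult ?k = floor_mult (?k - 1) \<or> floor_mult ?k = Suc (floor_mult (?k - 1))"
    using floor_mult_Suc[of "?k - 1"] Suc_diff_le[OF \<open>?k \<ge> 1\<close>] by simp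
  ultimately show ?thesis by linarith
qed

text \<open>The sum is the intermediate index for \<open>j + 1\<close>, whose floor grows by
  \<open>p\<close>, one more than the floor at the odd denominator: a carry occurs.\<close>

lemma floor_mult_add_den_odd:
  assumes "j < a (2 * m + 2)" "j \<ge> 1 \<or> m \<ge> 1"
  shows "floor_mult (den (2 * m) + j * den (Suc (2 * m)) + den (Suc (2 * m)))
     = Suc (floor_mult (den (2 * m) + j * den (Suc (2 * m))) + floor_mult (den (Suc (2 * m))))"
  using floor_mult_intermediate[of j m] floor_mult_intermediate[of "Suc j" m]
    floor_mult_den_odd[of m] assms by (simp add: algebra_simps)

text \<open>No carry occurs earlier: by best approximation \<open>i * \<omega>\<close> stays more
  than \<open>err (2 * m)\<close> below the next integer, while the fractional part at the
  intermediate index is at most \<open>err (2 * m)\<close>.\<close>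

lemma floor_mult_add_less_den_odd:
  assumes "j \<le> a (2 * m + 2)" "j \<ge> 1 \<or> m \<ge> 1" "i < den (Suc (2 * m))"
  shows "floor_mult (den (2 * m) + j * den (Suc (2 * m)) + i)
     = floor_mult (den (2 * m) + j * den (Suc (2 * m))) + floor_mult i"
proof (cases "i = 0")
  case True
  then show ?thesis by (simp add: floor_mult_0)
next
  case False
  let ?k = "den (2 * m) + j * den (Suc (2 * m))"
  let ?d = "err (2 * m) + real j * err (Suc (2 * m))"
  have "real i * \<omega> - (real (floor_mult i) + 1) < - err (2 * m)"
    using best_approximation[of "int i" m "int (floor_mult i) + 1"] floor_mult_bounds(2)[of i]
      False assms(3) by simp
  moreover have "real j * err (Suc (2 * m)) \<le> 0"
    using err_odd_neg[of m] by (intro mult_nonneg_nonpos) auto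
  ultimately have "real i * \<omega> + ?d < real (floor_mult i) + 1" by linarith
  moreover have "real (?k + i) * \<omega> = real (floor_mult ?k) + ?d + real i * \<omega>"
    using intermediate_mult[of m j] unfolding floor_mult_intermediate[OF assms(1,2)]
    by (simp add: algebra_simps)
  ultimately show ?thesis
    using err_intermediate_pos[OF assms(1)] floor_mult_bounds(1)[of i]
    by (intro floor_multI) auto
qed

end


section \<open>Words built from blocks 0 and 11\<close>

text \<open>The initial 1 counts as block 0. Then \<open>F k\<close> is the number of blocks 11
  among blocks 1 to \<open>k\<close>, and \<open>S k\<close> is the position where block
  \<open>k\<close> ends.\<close>

locale block_word =
  fixes F S e :: "nat \<Rightarrow> nat"
  assumes F_0: "F 0 = 0"
    and F_Suc: "F (Suc k) = F k \<or> F (Suc k) = Suc (F k)"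
    and S_eq: "S k = Suc (k + F k)"
    and e_1: "e (Suc 0) = 1"
    and e_block0: "F (Suc k) = F k \<Longrightarrow> e (Suc (S k)) = 0"
    and e_block1: "F (Suc k) = Suc (F k) \<Longrightarrow> e (Suc (S k)) = 1 \<and> e (Suc (Suc (S k))) = 1"
begin

text \<open>The initial 1 is matched with the second letter of block \<open>k\<close>. Additivity of
  \<open>F\<close> then gives blocks \<open>k + i\<close> and \<open>i\<close> the same type, so
  they match letter by letter.\<close>

lemma agree_upto:
  assumes k: "F k = Suc (F (k - 1))"
    and add: "\<And>i. i < I \<Longrightarrow> F (k + i) = F k + F i"
    and "i < I" "1 \<le> r" "r \<le> S i"
  shows "e (k + F k + r) = e r"
  using assms(3-5)
proof (induction i arbitrary: r)
  case 0
  then have r: "r = Suc 0" by (simp add: S_eq F_0)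
  obtain k' where k': "k = Suc k'" using k by (cases k) auto
  then have "e (Suc (Suc (S k'))) = 1" using e_block1 k by simp
  moreover have "k + F k + r = Suc (Suc (S k'))" using k k' r by (simp add: S_eq)
  ultimately show ?case using r e_1 by simp
next
  case (Suc i)
  have S: "k + F k + S i = S (k + i)"
    using add[of i] Suc.prems by (simp add: S_eq)
  have F: "F (Suc (k + i)) = F k + F (Suc i)" "F (k + i) = F k + F i"
    using add[of "Suc i"] add[of i] Suc.prems by simp_all
  show ?case
  proof (cases "r \<le> S i")
    case True
    then show ?thesis using Suc by simp
  next
    case False
    from F_Suc[of i] show ?thesis
    proof
      assume eq: "F (Suc i) = F i"
      then have "r = Suc (S i)" using False Suc.prems by (simp add: S_eq)
      then show ?thesis
        using e_block0[of i] e_block0[of "k + i"] eq F S by (metis add_Suc_right)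
    next
      assume eq: "F (Suc i) = Suc (F i)"
      then have "r = Suc (S i) \<or> r = Suc (Suc (S i))" using False Suc.prems by (simp add: S_eq) linarith
      then show ?thesis
        using e_block1[of i] e_block1[of "k + i"] eq F S by (metis add_Suc_right)
    qed
  qed
qed

lemma first_disagreement:
  assumes k: "F k = Suc (F (k - 1))"
    and add: "\<And>i. i < I \<Longrightarrow> F (k + i) = F k + F i"
    and I: "F (k + I) = Suc (F k + F I)"
  shows "(LEAST r. r \<ge> 1 \<and> e (k + F k + r) \<noteq> e r) = S I"
proof -
  obtain i where i: "I = Suc i"
    using I F_0 by (cases I) auto
  \<comment> \<open>Since \<open>F\<close> grows by at most 1 per step, the extra unit at
    \<open>I\<close> forces block \<open>I\<close> to be 0 and block \<open>k + I\<close> to be 11.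
    They differ in the first letter, which for the one-letter block \<open>I\<close> is position
    \<open>S I\<close>.\<close>
  have F: "F (Suc i) = F i" "F (Suc (k + i)) = Suc (F (k + i))" "F (k + i) = F k + F i"
    using F_Suc[of i] F_Suc[of "k + i"] add[of i] I i by auto
  have SI: "S I = Suc (S i)" and Sk: "k + F k + S I = Suc (S (k + i))"
    using F i by (simp_all add: S_eq)
  have "e (k + F k + S I) \<noteq> e (S I)"
    using e_block0[OF F(1)] e_block1[OF F(2)] unfolding Sk unfolding SI by simp
  moreover have "\<not> (r \<ge> 1 \<and> e (k + F k + r) \<noteq> e r)" if "r < S I" for r
    using agree_upto[OF k add, of I i r] i SI that by auto
  ultimately show ?thesis
    by (intro Least_equality) (auto simp: SI not_less[symmetric])
qed

text \<open>Blocks 1 to \<open>n\<close> are single zeros at positions 2 to \<open>n + 1\<close>;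
  the first block 11 follows. This computes \<open>kneading_kappa\<close>.\<close>

lemma second_one:
  assumes "F (Suc n) = 1" "F n = 0"
  shows "(LEAST i. i \<ge> 2 \<and> e i = 1) = n + 2"
proof -
  have F0: "F i = 0" if "i \<le> n" for i
  proof -
    have "incseq F"
      using F_Suc by (intro incseq_SucI) (metis le_Suc_eq order_refl)
    then show ?thesis using that assms(2) by (metis incseqD le_zero_eq)
  qed
  have "e (n + 2) = 1"
    using e_block1[of n] assms by (simp add: S_eq)
  moreover have "e i = 0" if i: "i \<ge> 2" "i < n + 2" for i
  proof -
    obtain i' where i': "i = Suc (Suc i')" using le_Suc_ex[OF i(1)] by auto
    then show ?thesis
      using e_block0[of i'] F0[of i'] F0[of "Suc i'"] i by (simp add: S_eq)
  qed
  ultimately show ?thesis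
    by (intro Least_equality) (auto simp: not_less[symmetric])
qed

end


section \<open>The kneading sequence of a map with kneading map bounded by 1\<close>

lemma crit_orbit_Suc: "crit_orbit f c (Suc n) = f (crit_orbit f c n)"
  by (simp add: crit_orbit_def)

lemma unimodal_orbit_mem:
  assumes "unimodal l u c f"
  shows "crit_orbit f c n \<in> {l..u}"
proof (induction n)
  case 0
  show ?case using assms by (simp add: unimodal_def crit_orbit_def)
next
  case (Suc n)
  then show ?case using assms unfolding unimodal_def crit_orbit_Suc by blast
qed

lemma unimodal_le_turning_value:
  assumes "unimodal l u c f" "x \<in> {l..u}"
  shows "f x \<le> f c"
proof (cases "x \<le> c")
  case True
  then show ?thesis
    using assms strict_mono_onD[of "{l..c}" f x c] by (cases "x = c") (auto simp: unimodal_def)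
next
  case False
  then show ?thesis
    using assms monotone_onD[of "{c..u}" "(<)" "(>)" f c x] by (auto simp: unimodal_def)
qed

section \<open>Letters read off between consecutive cutting times\<close>

lemma next_cutting_time:
  assumes "infinite (cutting_times f c)"
  shows "c \<in> cut_interval f c (cutting_time f c k)" "1 \<le> cutting_time f c k"
    "cutting_time f c k < cutting_time f c (Suc k)"
    "cutting_time f c k < n \<Longrightarrow> n < cutting_time f c (Suc k) \<Longrightarrow> c \<notin> cut_interval f c n"
proof -
  have "cutting_time f c k \<in> cutting_times f c"
    unfolding cutting_time_def by (rule enumerate_in_set[OF assms])
  then show "c \<in> cut_interval f c (cutting_time f c k)" "1 \<le> cutting_time f c k"
    by (auto simp: cutting_times_def)
  show "cutting_time f c k < cutting_time f c (Suc k)"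
    unfolding cutting_time_def by (rule enumerate_step[OF assms])
  assume *: "cutting_time f c k < n" "n < cutting_time f c (Suc k)"
  then have "n \<notin> cutting_times f c"
    unfolding cutting_time_def enumerate_Suc''[OF assms] using not_less_Least by blast
  with * show "c \<notin> cut_interval f c n" by (simp add: cutting_times_def)
qed

lemma cutting_time_0:
  assumes "infinite (cutting_times f c)"
  shows "cutting_time f c 0 = 1"
proof -
  have "1 \<in> cutting_times f c"
    by (simp add: cutting_times_def)
  then show ?thesis
    unfolding cutting_time_def enumerate_0
    by (intro Least_equality) (auto simp: cutting_times_def)
qed

lemma cut_interval_after_cutting:
  assumes "c \<in> cut_interval f c n" "n \<ge> 1"
  shows "cut_interval f c (Suc n) = closed_segment (crit_orbit f c (Suc n)) (crit_orbit f c 1)"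
  using assms by (cases n) auto

lemma cut_interval_after_noncutting:
  assumes "c \<notin> cut_interval f c n" "n \<ge> 1"
  shows "cut_interval f c (Suc n) = f ` cut_interval f c n"
  using assms by (cases n) auto

lemma kneading_block_short:
  assumes "normalized_unimodal l u c f" "infinite (cutting_times f c)"
    and "cutting_time f c (Suc k) = Suc (cutting_time f c k)"
  shows "kneading_seq f c (Suc (cutting_time f c k)) = 0"
proof -
  let ?s = "cutting_time f c k"
  have "c \<in> closed_segment (crit_orbit f c (Suc ?s)) (crit_orbit f c 1)"
    using next_cutting_time(1)[OF assms(2), of "Suc k"] next_cutting_time(1,2)[OF assms(2), of k]
    by (metis assms(3) cut_interval_after_cutting)
  moreover have "c < crit_orbit f c 1"
    using assms(1) by (simp add: normalized_unimodal_def)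
  \<comment> \<open>Only \<open>c_{s+1} \<le> c\<close> is known; \<open>kneading_seq\<close> takes
    the value 0 in the case of equality as well.\<close>
  ultimately show ?thesis
    by (auto simp: kneading_seq_def closed_segment_eq_real_ivl split: if_splits)
qed

text \<open>The interval \<open>[c_{s+1}, c_1]\<close> misses \<open>c\<close>, so it lies to the
  right of \<open>c\<close>, where \<open>f\<close> decreases. Its image contains \<open>c\<close>
  and has maximum \<open>c_{s+2}\<close>. Strictness of the second bound needs the next gap.\<close>

lemma kneading_block_long_weak:
  assumes f: "normalized_unimodal l u c f" and inf: "infinite (cutting_times f c)"
    and two: "cutting_time f c (Suc k) = Suc (Suc (cutting_time f c k))"
  shows "c < crit_orbit f c (Suc (cutting_time f c k))"
    "c \<le> crit_orbit f c (Suc (Suc (cutting_time f c k)))"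
proof -
  let ?s = "cutting_time f c k"
  let ?x = "crit_orbit f c (Suc ?s)" and ?y = "crit_orbit f c (Suc 0)"
  have uni: "unimodal l u c f" and c1: "c < ?y"
    using f by (auto simp: normalized_unimodal_def)
  have mem: "?x \<in> {l..u}" "?y \<in> {l..u}" "?x \<le> ?y"
    using unimodal_orbit_mem[OF uni, of "Suc ?s"] unimodal_orbit_mem[OF uni, of "Suc 0"]
      unimodal_le_turning_value[OF uni unimodal_orbit_mem[OF uni, of ?s]]
    by (auto simp: crit_orbit_Suc[of f c ?s]) (simp add: crit_orbit_def)
  have seg: "cut_interval f c (Suc ?s) = {?x..?y}"
    using cut_interval_after_cutting[OF next_cutting_time(1,2)[OF inf, of k]] mem(3)
    by (simp add: closed_segment_eq_real_ivl)
  have nin: "c \<notin> cut_interval f c (Suc ?s)"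
    using next_cutting_time(4)[OF inf, of k "Suc ?s"] two by simp
  then show x: "c < ?x" using seg c1 by auto
  have "c \<in> f ` {?x..?y}"
    using next_cutting_time(1)[OF inf, of "Suc k"] two cut_interval_after_noncutting[OF nin] seg
    by simp
  then obtain z where z: "c = f z" "?x \<le> z" "z \<le> ?y" by auto
  have "f z \<le> f ?x"
    using uni x z(2,3) mem monotone_onD[of "{c..u}" "(<)" "(>)" f ?x z]
    by (cases "z = ?x") (auto simp: unimodal_def)
  then show "c \<le> crit_orbit f c (Suc (Suc ?s))"
    unfolding crit_orbit_Suc[of f c "Suc ?s"] by (simp only: z(1)[symmetric])
qed

text \<open>If \<open>c\<close> returned to itself at the end of a block, the intervals of the next two times would
  be the points \<open>c\<^sub>1\<close> and \<open>c\<^sub>2\<close>, neither of which is \<open>c\<close>; so the next block would be too long.\<close>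

lemma turning_point_not_hit_at_cutting_time:
  assumes f: "normalized_unimodal l u c f" and inf: "infinite (cutting_times f c)"
    and gap: "cutting_time f c (Suc k) \<le> cutting_time f c k + 2"
  shows "crit_orbit f c (cutting_time f c k) \<noteq> c"
proof
  let ?s = "cutting_time f c k"
  assume hit: "crit_orbit f c ?s = c"
  have ne: "crit_orbit f c 1 \<noteq> c" "crit_orbit f c 2 \<noteq> c"
    using f by (auto simp: normalized_unimodal_def)
  have "crit_orbit f c (Suc ?s) = crit_orbit f c 1"
    using hit by (simp add: crit_orbit_Suc) (simp add: crit_orbit_def)
  then have 1: "cut_interval f c (Suc ?s) = {crit_orbit f c 1}"
    using cut_interval_after_cutting[OF next_cutting_time(1,2)[OF inf, of k]] by simp
  then have "cut_interval f c (Suc (Suc ?s)) = {crit_orbit f c 2}"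
    using ne cut_interval_after_noncutting[of c f "Suc ?s"]
    by (auto simp: crit_orbit_def numeral_2_eq_2)
  with 1 ne have "c \<notin> cut_interval f c (Suc ?s)" "c \<notin> cut_interval f c (Suc (Suc ?s))"
    by auto
  moreover have "cutting_time f c (Suc k) = Suc ?s \<or> cutting_time f c (Suc k) = Suc (Suc ?s)"
    using gap next_cutting_time(3)[OF inf, of k] by linarith
  ultimately show False
    using next_cutting_time(1)[OF inf, of "Suc k"] by auto
qed

text \<open>The second letter sits at the next cutting time, where the bound on the following gap
  excludes a return to \<open>c\<close>.\<close>

lemma kneading_block_long:
  assumes "normalized_unimodal l u c f" "infinite (cutting_times f c)"
    and "cutting_time f c (Suc k) = Suc (Suc (cutting_time f c k))"
    and "cutting_time f c (Suc (Suc k)) \<le> cutting_time f c (Suc k) + 2"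
  shows "kneading_seq f c (Suc (cutting_time f c k)) = 1
    \<and> kneading_seq f c (Suc (Suc (cutting_time f c k))) = 1"
  using kneading_block_long_weak[OF assms(1-3)]
    turning_point_not_hit_at_cutting_time[OF assms(1,2,4)] assms(3)
  by (auto simp: kneading_seq_def)

section \<open>Cutting and co-cutting times of maps in the class\<close>

context cf_below_half
begin

context
  fixes l u c :: real and f :: "real \<Rightarrow> real"
  assumes in_class: "in_S_class \<gamma> l u c f"
begin

lemma normalized: "normalized_unimodal l u c f"
  and inf_cutting: "infinite (cutting_times f c)"
  and kneading_map: "cutting_time f c (Suc k) - cutting_time f c k
        = cutting_time f c (floor_mult (Suc k) - floor_mult k)"
proof -
  show "normalized_unimodal l u c f" "infinite (cutting_times f c)"
    using in_class by (auto simp: in_S_class_def has_kneading_map_def)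
  have "\<forall>k\<ge>1. cutting_time f c k - cutting_time f c (k - 1) = cutting_time f c (kneading_Q \<gamma> k)"
    using in_class by (simp add: in_S_class_def has_kneading_map_def)
  then show "cutting_time f c (Suc k) - cutting_time f c k
      = cutting_time f c (floor_mult (Suc k) - floor_mult k)"
    unfolding kneading_Q_Suc[symmetric] by (metis diff_Suc_1 le_add1 plus_1_eq_Suc)
qed

lemma cutting_time_Suc:
  "cutting_time f c (Suc k) = cutting_time f c k + Suc (floor_mult (Suc k) - floor_mult k)"
proof -
  have f1: "floor_mult (Suc 0) = 0"
    using omega_pos omega_less by (intro floor_multI) auto
  have S0: "cutting_time f c 0 = 1" by (rule cutting_time_0[OF inf_cutting])
  \<comment> \<open>As \<open>\<omega> < 1\<close>, the kneading map is 0 at 1. With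
    \<open>S 0 = 1\<close> and \<open>S 1 = 2\<close>, every gap \<open>S (Q k)\<close> equals
    \<open>Q k + 1\<close>.\<close>
  have S1: "cutting_time f c (Suc 0) = 2"
    using kneading_map[of 0] next_cutting_time(3)[OF inf_cutting, of 0] f1 S0
    by (simp add: floor_mult_0)
  show ?thesis
    using floor_mult_Suc[of k] kneading_map[of k] next_cutting_time(3)[OF inf_cutting, of k] S0 S1
    by auto
qed

lemma cutting_time_eq: "cutting_time f c k = Suc (k + floor_mult k)"
proof (induction k)
  case 0
  show ?case by (simp add: cutting_time_0[OF inf_cutting] floor_mult_0)
next
  case (Suc k)
  then show ?case using cutting_time_Suc[of k] floor_mult_Suc[of k] by auto
qed

lemma block_word_kneading: "block_word floor_mult (cutting_time f c) (kneading_seq f c)"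
proof
  fix k
  show "kneading_seq f c (Suc 0) = 1"
    using normalized by (simp add: normalized_unimodal_def kneading_seq_def)
  show "kneading_seq f c (Suc (cutting_time f c k)) = 0" if "floor_mult (Suc k) = floor_mult k"
    using kneading_block_short[OF normalized inf_cutting] cutting_time_Suc[of k] that by simp
  show "kneading_seq f c (Suc (cutting_time f c k)) = 1
      \<and> kneading_seq f c (Suc (Suc (cutting_time f c k))) = 1"
    if "floor_mult (Suc k) = Suc (floor_mult k)"
    using kneading_block_long[OF normalized inf_cutting, of k] that
      cutting_time_Suc[of k] cutting_time_Suc[of "Suc k"] floor_mult_Suc[of "Suc k"] by auto
qed (use floor_mult_0 floor_mult_Suc cutting_time_eq in auto)

interpretation block_word floor_mult "cutting_time f c" "kneading_seq f c"
  by (rule block_word_kneading)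

lemma cutting_time_den_odd: "cutting_time f c (den (Suc (2 * m))) = cf_q a (Suc (2 * m))"
  using cutting_time_eq[of "den (Suc (2 * m))"] floor_mult_den_odd[of m] p_plus_den[of "Suc (2 * m)"]
  by simp

text \<open>The block 11 with intermediate index \<open>k\<close> starts at
  \<open>k + floor_mult k\<close>, the position in question. The first carry comes from
  \<open>den (2 * m + 1)\<close>, whose cutting time is the odd denominator.\<close>

lemma disagreement_intermediate:
  assumes "j < a (2 * m + 2)" "j \<ge> 1 \<or> m \<ge> 1"
  shows "disagreement f c (cf_q a (2 * m) + j * cf_q a (Suc (2 * m))) = cf_q a (Suc (2 * m))"
proof -
  let ?k = "den (2 * m) + j * den (Suc (2 * m))"
  have "?k + floor_mult ?k = cf_q a (2 * m) + j * cf_q a (Suc (2 * m))"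
    unfolding floor_mult_intermediate[OF less_imp_le[OF assms(1)] assms(2)] p_plus_den[symmetric]
    by (simp add: algebra_simps)
  moreover have "(LEAST r. r \<ge> 1 \<and> kneading_seq f c (?k + floor_mult ?k + r) \<noteq> kneading_seq f c r)
      = cutting_time f c (den (Suc (2 * m)))"
    using assms floor_mult_intermediate_pred[of j m] floor_mult_add_less_den_odd[of j m]
      floor_mult_add_den_odd[of j m]
    by (intro first_disagreement) auto
  ultimately show ?thesis
    by (simp add: disagreement_def cutting_time_den_odd)
qed

text \<open>The first block 11 has index \<open>den 0 + den 1\<close>, the intermediate index for
  \<open>m = 0\<close> and \<open>j = 1\<close>.\<close>

lemma kneading_kappa_eq: "kneading_kappa f c = cf_q a 0 + cf_q a 1"
proof -
  have "floor_mult (den 1) = 0"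
    using floor_mult_den_odd[of 0] by simp
  moreover have "floor_mult (Suc (den 1)) = 1"
    using floor_mult_intermediate[of 1 0] a_pos[of 2] by (simp add: den_def numeral_2_eq_2)
  ultimately show ?thesis
    using second_one[of "den 1"] a1_ge_2 by (simp add: kneading_kappa_def den_def)
qed

text \<open>Within level \<open>m\<close> each step adds the same odd denominator, raising
  \<open>j\<close> by 1. At \<open>j = a (2 * m + 2)\<close> the value is
  \<open>q (2 * m + 2)\<close>, which is the entry \<open>j = 0\<close> of level
  \<open>m + 1\<close>.\<close>

lemma cocutting_time_intermediate:
  assumes "1 \<le> j" "j \<le> a (2 * m + 2)"
  shows "cocutting_time f c (even_quotient_sum a m + j - 1)
    = cf_q a (2 * m) + j * cf_q a (Suc (2 * m))"
  using assms
proof (induction m arbitrary: j)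
  case 0
  from 0 show ?case
  proof (induction j rule: dec_induct)
    case base
    show ?case by (simp add: even_quotient_sum_def kneading_kappa_eq)
  next
    case (step j)
    then obtain j' where "j = Suc j'" by (cases j) auto
    with step show ?case
      using disagreement_intermediate[of j 0] by (simp add: even_quotient_sum_def)
  qed
next
  case (Suc m)
  let ?A = "even_quotient_sum a (Suc m)"
  have A: "?A = even_quotient_sum a m + a (2 * m + 2)"
    by (simp add: even_quotient_sum_def)
  have pos: "a (2 * m + 2) \<ge> 1" by (rule a_pos) simp
  have IH: "cocutting_time f c (?A - 1) = cf_q a (2 * Suc m)"
    using Suc.IH[of "a (2 * m + 2)"] pos A by simp
  \<comment> \<open>Crossing between levels uses the disagreement formula with \<open>j = 0\<close>,
    allowed because the new level is at least 1.\<close>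
  have start: "cocutting_time f c ?A = cf_q a (2 * Suc m) + cf_q a (Suc (2 * Suc m))"
  proof -
    have "?A = Suc (?A - 1)" using A pos by simp
    then have "cocutting_time f c ?A
        = cf_q a (2 * Suc m) + disagreement f c (cf_q a (2 * Suc m))"
      by (metis IH cocutting_time.simps(2))
    then show ?thesis
      using disagreement_intermediate[of 0 "Suc m"] a_pos[of "2 * Suc m + 2"] by simp
  qed
  from Suc.prems show ?case
  proof (induction j rule: dec_induct)
    case base
    show ?case using start by simp
  next
    case (step j)
    then have "?A + Suc j - 1 = Suc (?A + j - 1)" by simp
    moreover have "cocutting_time f c (?A + j - 1)
        = cf_q a (2 * Suc m) + j * cf_q a (Suc (2 * Suc m))"
      using step by (simp del: cf_q.simps)
    ultimately have "cocutting_time f c (?A + Suc j - 1)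
        = cf_q a (2 * Suc m) + j * cf_q a (Suc (2 * Suc m))
          + disagreement f c (cf_q a (2 * Suc m) + j * cf_q a (Suc (2 * Suc m)))"
      by (simp only: cocutting_time.simps)
    then show ?case
      using disagreement_intermediate[of j "Suc m"] step by simp
  qed
qed

end

end

theorem theorem3p8:
  fixes \<gamma> l u c :: real and f :: "real \<Rightarrow> real" and a :: "nat \<Rightarrow> nat"
  assumes "0 < \<gamma>" and "\<gamma> < 1 / 2" and "\<gamma> \<notin> \<rat>"
    and "has_cf_expansion \<gamma> a"
    and "in_S_class \<gamma> l u c f"
  shows "(\<forall>m. \<forall>j. 1 \<le> j \<and> j \<le> a (2 * m + 2) \<longrightarrow>
            cocutting_time f c (even_quotient_sum a m + j - 1)
              = cf_q a (2 * m) + j * cf_q a (2 * m + 1))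
       \<and> (\<forall>m\<ge>1. cocutting_time f c (even_quotient_sum a m - 1) = cf_q a (2 * m)
             \<and> cocutting_time f c (even_quotient_sum a m) = cf_q a (2 * m) + cf_q a (2 * m + 1))
       \<and> (\<forall>m. cutting_time f c (cf_q a (2 * m + 1) - cf_p a (2 * m + 1)) = cf_q a (2 * m + 1))
       \<and> (\<forall>m\<ge>1. disagreement f c (cf_q a (2 * m)) = cf_q a (2 * m + 1))"
proof -
  interpret cf_below_half \<gamma> a
    using assms by unfold_locales
  note co = cocutting_time_intermediate[OF assms(5)]
  have 1: "cocutting_time f c (even_quotient_sum a m - 1) = cf_q a (2 * m)
      \<and> cocutting_time f c (even_quotient_sum a m) = cf_q a (2 * m) + cf_q a (2 * m + 1)"
    if m: "m \<ge> 1" for m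
  proof -
    \<comment> \<open>Index \<open>A_m - 1\<close> is the last one of level
      \<open>n = m - 1\<close>, with \<open>j = a (2 * n + 2)\<close>.\<close>
    obtain n where n: "m = Suc n" using m by (cases m) auto
    have "cocutting_time f c (even_quotient_sum a m - 1) = cf_q a (2 * m)"
      using co[of "a (2 * n + 2)" n] a_pos[of "2 * n + 2"] by (simp add: n even_quotient_sum_def)
    then show ?thesis
      using co[of 1 m] a_pos[of "2 * m + 2"] by simp
  qed
  have 2: "disagreement f c (cf_q a (2 * m)) = cf_q a (2 * m + 1)" if "m \<ge> 1" for m
    using disagreement_intermediate[OF assms(5), of 0 m] a_pos[of "2 * m + 2"] that by simp
  show ?thesis
    using co 1 2 cutting_time_den_odd[OF assms(5)] by (simp add: den_def)
qed

end
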